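(* Let $s\ge1$, let $b_i,a_{ij}$ ($i,j=1,\dots,s$) be arbitrary real numbers (i.e. any Runge-Kutta method), and let $\tau>0$. Suppose that $(U^n,Q^n)\in\mathbb{R}^N\times\mathbb{R}^N$, $n=0,1,2,\dots$, are generated by the scheme $$K_i^n=\mathcal J_h\Big(\kappa U^{ni}+bD_2U^{ni}+\frac\beta3\big(Q^{ni}+2(U^{ni})^2\big)\Big),\qquad L_i^n=2U^{ni}\cdot K_i^n,$$ $$U^{ni}=U^n+\tau\sum_{j=1}^sa_{ij}K_j^n,\qquad Q^{ni}=Q^n+\tau\sum_{j=1}^sa_{ij}L_j^n,\qquad i=1,\dots,s,$$ $$U^{n+1}=U^n+\tau\sum_{i=1}^sb_iK_i^n,\qquad Q^{n+1}=Q^n+\tau\sum_{i=1}^sb_iL_i^n,$$ with all stage vectors in $\mathbb{R}^N$. Then the scheme conserves the discrete mass: $$M_h^{n+1}=M_h^n,\qquad M_h^n=\langle U^n,\mathbf 1\rangle_h,\qquad n=0,1,2,\dots.$$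
   Context: $\kappa,b,\beta,\delta,\alpha$ are real constants with $\delta>0$, $\alpha>0$ (the constant $b$ is distinct from the Runge-Kutta weights $b_i$); $\Omega=[x_l,x_r]$ is a bounded interval. $N$ is an even positive integer, $h=(x_r-x_l)/N$, $\mu=2\pi/(x_r-x_l)$, grid points $x_j=jh$. For $0\le j\le N-1$ let $$l_j(x)=\frac1N\sum_{k=-N/2}^{N/2}\frac1{c_k}e^{\mathrm{i}k\mu(x-x_j)},\qquad c_k=1\text{ if }|k|<N/2,\quad c_k=2\text{ if }|k|=N/2,$$ and define the $N\times N$ (real) Fourier spectral differentiation matrices $D_r$ by $(D_r)_{j,k}=\frac{d^r l_k}{dx^r}(x_j)$, $0\le j,k\le N-1$. Put $\mathcal J_h=-(I-\delta D_2+\alpha D_4)^{-1}D_1$ with $I$ the identity matrix. $U\cdot V$ denotes the componentwise product of vectors, $U^2=U\cdot U$, $\mathbf 1$ is the all-ones vector in $\mathbb{R}^N$, and $\langle U,V\rangle_h=h\sum_{j=0}^{N-1}u_jv_j$. (The scheme corresponds to the generalized Rosenau-type equation with nonlinearity exponent $p=2$.) *)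

theory Defs
  imports "HOL-Analysis.Complex_Transcendental" "Jordan_Normal_Form.Gauss_Jordan_Elimination"
begin

definition mesh_size :: "nat \<Rightarrow> real \<Rightarrow> real \<Rightarrow> real" where
  "mesh_size N xl xr = (xr - xl) / real N"

definition wave_number :: "real \<Rightarrow> real \<Rightarrow> real" where
  "wave_number xl xr = 2 * pi / (xr - xl)"

definition grid_point :: "nat \<Rightarrow> real \<Rightarrow> real \<Rightarrow> nat \<Rightarrow> real" where
  "grid_point N xl xr j = real j * mesh_size N xl xr"

text \<open>For even \<open>N\<close>, the integer quotient \<open>int N div 2\<close> is exactly \<open>N/2\<close>.\<close>

definition fourier_weight :: "nat \<Rightarrow> int \<Rightarrow> real" where
  "fourier_weight N k = (if \<bar>k\<bar> < int N div 2 then 1 else 2)"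

definition fourier_basis_complex :: "nat \<Rightarrow> real \<Rightarrow> real \<Rightarrow> nat \<Rightarrow> real \<Rightarrow> complex" where
  "fourier_basis_complex N xl xr j x =
     (1 / of_nat N) * (\<Sum>k\<in>{- (int N div 2)..int N div 2}.
        (1 / of_real (fourier_weight N k)) *
        exp (\<i> * of_int k * of_real (wave_number xl xr) * of_real (x - grid_point N xl xr j)))"

text \<open>The complex trigonometric sum takes real values at real arguments, as shown below, so
  passing to the real part only changes its type.\<close>

definition fourier_basis :: "nat \<Rightarrow> real \<Rightarrow> real \<Rightarrow> nat \<Rightarrow> real \<Rightarrow> real" where
  "fourier_basis N xl xr j x = Re (fourier_basis_complex N xl xr j x)"

lemma of_real_fourier_basis:
  "complex_of_real (fourier_basis N xl xr j x) = fourier_basis_complex N xl xr j x"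
proof -
  let ?S = "{- (int N div 2)..int N div 2}"
  let ?f = "\<lambda>k. (1 / of_real (fourier_weight N k)) *
        exp (\<i> * of_int k * of_real (wave_number xl xr) * of_real (x - grid_point N xl xr j))"
  have cnj_f: "cnj (?f k) = ?f (- k)" for k
    by (simp add: fourier_weight_def exp_cnj)
  have "cnj (\<Sum>k\<in>?S. ?f k) = (\<Sum>k\<in>?S. ?f (- k))"
    unfolding cnj_sum by (rule sum.cong[OF refl cnj_f])
  also have "\<dots> = (\<Sum>k\<in>?S. ?f k)"
    by (rule sum.reindex_bij_witness[of _ uminus uminus]) auto
  finally have "cnj (fourier_basis_complex N xl xr j x) = fourier_basis_complex N xl xr j x"
    unfolding fourier_basis_complex_def by simp
  then show ?thesis
    unfolding fourier_basis_def by (metis Reals_cnj_iff of_real_Re)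
qed

definition diff_mat :: "nat \<Rightarrow> real \<Rightarrow> real \<Rightarrow> nat \<Rightarrow> real mat" where
  "diff_mat N xl xr r =
     mat N N (\<lambda>(j, k). (deriv ^^ r) (fourier_basis N xl xr k) (grid_point N xl xr j))"

text \<open>The matrix inverted here is circulant with eigenvalues
  \<open>1 + \<delta> (k\<mu>)\<^sup>2 + \<alpha> (k\<mu>)\<^sup>4\<close>, so for \<open>\<delta>, \<alpha> > 0\<close>
  \<open>mat_inverse\<close> returns \<open>Some\<close> of the genuine inverse.\<close>

definition J_mat :: "nat \<Rightarrow> real \<Rightarrow> real \<Rightarrow> real \<Rightarrow> real \<Rightarrow> real mat" where
  "J_mat N xl xr \<delta> \<alpha> =
     - (the (mat_inverse (1\<^sub>m N - \<delta> \<cdot>\<^sub>m diff_mat N xl xr 2 + \<alpha> \<cdot>\<^sub>m diff_mat N xl xr 4))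
        * diff_mat N xl xr 1)"

definition vec_times :: "real vec \<Rightarrow> real vec \<Rightarrow> real vec" (infixl \<open>\<odot>\<close> 70) where
  "u \<odot> v = vec (dim_vec u) (\<lambda>j. u $ j * v $ j)"

definition discrete_inner :: "nat \<Rightarrow> real \<Rightarrow> real \<Rightarrow> real vec \<Rightarrow> real vec \<Rightarrow> real" where
  "discrete_inner N xl xr u v = mesh_size N xl xr * (\<Sum>j = 0..<N. u $ j * v $ j)"

definition ones_vec :: "nat \<Rightarrow> real vec" where
  "ones_vec N = vec N (\<lambda>_. 1)"

definition discrete_mass :: "nat \<Rightarrow> real \<Rightarrow> real \<Rightarrow> real vec \<Rightarrow> real" where
  "discrete_mass N xl xr u = discrete_inner N xl xr u (ones_vec N)"

end

theory Submission
  imports Defs "Jordan_Normal_Form.Determinant"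
begin

text \<open>
  The increment \<open>U (Suc n) - U n\<close> is a linear combination of the stages \<open>K n i\<close>, each of which lies in
  the range of \<open>J_mat\<close>.  So everything reduces to one linear fact: every vector in the range of
  \<open>J_mat\<close> has entry sum zero (\<open>sum_J_mat_mult_vec\<close>).

  Each column of \<open>diff_mat N xl xr r\<close> with \<open>r \<ge> 1\<close> samples a trigonometric polynomial at the grid points
  that has no constant mode and only frequencies \<open>0 < \<bar>k\<bar> \<le> N / 2 < N\<close>; such frequencies
  do not alias to the constant, so the column sums to zero (\<open>sum_diff_mat_column\<close>).
  Write \<open>A = I - \<delta> D\<^sub>2 + \<alpha> D\<^sub>4\<close>.  Then \<open>A y\<close> and \<open>y\<close> have the same entry sum for every \<open>y\<close>, hence so
  do \<open>z\<close> and the solution \<open>y\<close> of \<open>A y = z\<close>.  For \<open>z = D\<^sub>1 x\<close> that sum is zero.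

  It remains to see that \<open>A\<close> is invertible, as otherwise \<open>the (mat_inverse A)\<close> is an unspecified
  matrix.  The addition theorem for the cosine writes the quadratic form of \<open>D\<^bsub>2m\<^esub>\<close> as
  \<open>(-1) ^ m\<close> times a sum of squares (\<open>diff_mat_even_quadratic_form_sign\<close>), so the quadratic
  form of \<open>A\<close> dominates the sum of the squares of the entries, and \<open>A\<close> has trivial kernel.
\<close>

section \<open>Entries of the differentiation matrices\<close>

lemma fourier_basis_eq_cos_sum:
  "fourier_basis N xl xr j x =
     (1 / real N) * (\<Sum>k\<in>{- (int N div 2)..int N div 2}.
        1 / fourier_weight N k * cos (real_of_int k * wave_number xl xr * (x - grid_point N xl xr j)))"
proof -
  have "exp (\<i> * of_int k * of_real (wave_number xl xr) * of_real (x - grid_point N xl xr j))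
      = cis (real_of_int k * wave_number xl xr * (x - grid_point N xl xr j))" for k
    by (simp add: cis_conv_exp mult.assoc)
  moreover have "complex_of_real (1 / real N) = 1 / of_nat N"
    by simp
  moreover have "complex_of_real (1 / fourier_weight N k) = 1 / of_real (fourier_weight N k)" for k
    by simp
  ultimately have "fourier_basis_complex N xl xr j x =
     complex_of_real (1 / real N) * (\<Sum>k\<in>{- (int N div 2)..int N div 2}.
        complex_of_real (1 / fourier_weight N k) *
        cis (real_of_int k * wave_number xl xr * (x - grid_point N xl xr j)))"
    unfolding fourier_basis_complex_def by presburger
  then show ?thesis
    unfolding fourier_basis_def by (simp del: of_real_divide)
qed

text \<open>Differentiating a cosine is a quarter-period phase shift, which gives all orders of derivative
  one common formula.\<close>

lemma higher_deriv_cos_sum: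
  fixes w c :: "'i \<Rightarrow> real"
  shows "(deriv ^^ r) (\<lambda>x. C * (\<Sum>k\<in>S. w k * cos (c k * (x - y))))
       = (\<lambda>x. C * (\<Sum>k\<in>S. w k * (c k ^ r * cos (c k * (x - y) + real r * (pi / 2)))))"
proof (induction r)
  case 0
  show ?case by simp
next
  case (Suc r)
  have shift: "cos (t + real (Suc r) * (pi / 2)) = - sin (t + real r * (pi / 2))" for t
    using minus_sin_cos_eq[of "t + real r * (pi / 2)"]
    by (simp add: algebra_simps add_divide_distrib)
  have "((\<lambda>x. C * (\<Sum>k\<in>S. w k * (c k ^ r * cos (c k * (x - y) + real r * (pi / 2)))))
      has_real_derivative
      C * (\<Sum>k\<in>S. w k * (c k ^ Suc r * cos (c k * (x - y) + real (Suc r) * (pi / 2))))) (at x)" for x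
    unfolding shift
    by (intro DERIV_cmult DERIV_sum) (auto intro!: derivative_eq_intros)
  then show ?case
    by (simp only: funpow.simps o_apply Suc.IH) (rule ext, rule DERIV_imp_deriv)
qed

lemma diff_mat_index:
  assumes "j < N" "l < N"
  shows "diff_mat N xl xr r $$ (j, l) =
    (1 / real N) * (\<Sum>k\<in>{- (int N div 2)..int N div 2}. 1 / fourier_weight N k *
       ((real_of_int k * wave_number xl xr) ^ r *
        cos (real_of_int k * wave_number xl xr * (grid_point N xl xr j - grid_point N xl xr l)
             + real r * (pi / 2))))"
proof -
  have "fourier_basis N xl xr l =
     (\<lambda>x. (1 / real N) * (\<Sum>k\<in>{- (int N div 2)..int N div 2}.
        1 / fourier_weight N k * cos (real_of_int k * wave_number xl xr * (x - grid_point N xl xr l))))"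
    by (rule ext) (rule fourier_basis_eq_cos_sum)
  then have "(deriv ^^ r) (fourier_basis N xl xr l) =
     (\<lambda>x. (1 / real N) * (\<Sum>k\<in>{- (int N div 2)..int N div 2}. 1 / fourier_weight N k *
       ((real_of_int k * wave_number xl xr) ^ r *
        cos (real_of_int k * wave_number xl xr * (x - grid_point N xl xr l)
             + real r * (pi / 2)))))"
    by (simp only: higher_deriv_cos_sum)
  moreover have "diff_mat N xl xr r $$ (j, l)
      = (deriv ^^ r) (fourier_basis N xl xr l) (grid_point N xl xr j)"
    using assms by (simp add: diff_mat_def)
  ultimately show ?thesis
    by (simp only:)
qed

lemma diff_mat_carrier [simp]: "diff_mat N xl xr r \<in> carrier_mat N N"
  by (simp add: diff_mat_def)

lemma mult_mat_vec_index_sum: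
  assumes "M \<in> carrier_mat N N" "v \<in> carrier_vec N" "j < N"
  shows "(M *\<^sub>v v) $ j = (\<Sum>l = 0..<N. M $$ (j, l) * v $ l)"
  using assms by (auto simp: scalar_prod_def)

section \<open>Column sums\<close>

text \<open>The numbers \<open>cis (2 \<pi> k j / N)\<close> form a geometric progression in \<open>j\<close> with ratio an \<open>N\<close>-th root of
  unity other than \<open>1\<close>, so they cancel; the phase \<open>\<phi>\<close> only rotates the sum.\<close>

lemma sum_cos_roots_of_unity:
  fixes k :: int
  assumes "0 < \<bar>k\<bar>" "\<bar>k\<bar> < int N"
  shows "(\<Sum>j = 0..<N. cos (2 * pi * real_of_int k / real N * real j + \<phi>)) = 0"
proof -
  define w where "w = cis (2 * pi * real_of_int k / real N)"
  have N: "N > 0" using assms by linarith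
  have "w \<noteq> 1"
  proof
    assume "w = 1"
    then have "exp (\<i> * complex_of_real (2 * pi * real_of_int k / real N)) = 1"
      by (simp add: w_def cis_conv_exp)
    then obtain n :: int where "2 * pi * real_of_int k / real N = real_of_int (2 * n) * pi"
      by (auto simp: exp_eq_1)
    then have "real_of_int k = real_of_int (n * int N)"
      using N by (simp add: field_simps)
    then have "k = n * int N"
      by linarith
    then have "int N dvd k"
      by simp
    then show False
      using assms dvd_imp_le_int[of k "int N"] by auto
  qed
  moreover have "w ^ N = 1"
  proof -
    have "w ^ N = cis (real_of_int k * (2 * pi))"
      unfolding w_def Complex.DeMoivre using N by (intro arg_cong[of _ _ cis]) simp
    also have "\<dots> = 1"
      using cis_multiple_2pi[of "real_of_int k"] by (simp add: mult.commute)
    finally show ?thesis .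
  qed
  ultimately have "(\<Sum>j<N. w ^ j) = 0"
    by (simp add: geometric_sum)
  then have "Re (cis \<phi> * (\<Sum>j<N. w ^ j)) = 0"
    by simp
  also have "cis \<phi> * (\<Sum>j<N. w ^ j)
      = (\<Sum>j<N. cis (2 * pi * real_of_int k / real N * real j + \<phi>))"
    unfolding sum_distrib_left
    by (intro sum.cong) (simp_all add: w_def Complex.DeMoivre cis_mult algebra_simps)
  finally show ?thesis
    by (simp add: atLeast0LessThan)
qed

lemma sum_diff_mat_column:
  assumes "xl < xr" "r \<ge> 1" "l < N"
  shows "(\<Sum>j = 0..<N. diff_mat N xl xr r $$ (j, l)) = 0"
proof -
  let ?S = "{- (int N div 2)..int N div 2}"
  let ?c = "\<lambda>k. real_of_int k * wave_number xl xr"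
  let ?x = "grid_point N xl xr"
  let ?t = "\<lambda>k j. 1 / fourier_weight N k *
       (?c k ^ r * cos (?c k * (?x j - ?x l) + real r * (pi / 2)))"
  have mode: "(\<Sum>j = 0..<N. ?t k j) = 0" if k: "k \<in> ?S" for k
  proof (cases "k = 0")
    case True
    \<comment> \<open>The constant mode is the only one that does not cancel in the sum; it is killed by the
      factor \<open>0 ^ r\<close>.\<close>
    then show ?thesis using assms by (simp add: power_0_left)
  next
    case False
    define \<phi> where "\<phi> = real r * (pi / 2) - ?c k * ?x l"
    have "?c k * ?x j = 2 * pi * real_of_int k / real N * real j" for j
      using assms by (simp add: wave_number_def grid_point_def mesh_size_def field_simps)
    then have angle: "?c k * (?x j - ?x l) + real r * (pi / 2)
        = 2 * pi * real_of_int k / real N * real j + \<phi>" for j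
      unfolding \<phi>_def right_diff_distrib by simp
    have "\<bar>k\<bar> < int N" using k assms by auto
    then have cancel: "(\<Sum>j = 0..<N. cos (?c k * (?x j - ?x l) + real r * (pi / 2))) = 0"
      unfolding angle using False by (intro sum_cos_roots_of_unity) auto
    have "(\<Sum>j = 0..<N. ?t k j) = 1 / fourier_weight N k *
        (?c k ^ r * (\<Sum>j = 0..<N. cos (?c k * (?x j - ?x l) + real r * (pi / 2))))"
      by (simp only: sum_distrib_left)
    then show ?thesis
      unfolding cancel by simp
  qed
  have "(\<Sum>j = 0..<N. diff_mat N xl xr r $$ (j, l)) = (\<Sum>j = 0..<N. (1 / real N) * (\<Sum>k\<in>?S. ?t k j))"
    using assms by (intro sum.cong refl diff_mat_index) auto
  also have "\<dots> = (1 / real N) * (\<Sum>j = 0..<N. \<Sum>k\<in>?S. ?t k j)"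
    by (rule sum_distrib_left[symmetric])
  also have "(\<Sum>j = 0..<N. \<Sum>k\<in>?S. ?t k j) = (\<Sum>k\<in>?S. \<Sum>j = 0..<N. ?t k j)"
    by (rule sum.swap)
  also have "(\<Sum>k\<in>?S. \<Sum>j = 0..<N. ?t k j) = 0"
    by (rule sum.neutral) (use mode in blast)
  finally show ?thesis by simp
qed

lemma sum_diff_mat_mult_vec:
  assumes "xl < xr" "r \<ge> 1" "v \<in> carrier_vec N"
  shows "(\<Sum>j = 0..<N. (diff_mat N xl xr r *\<^sub>v v) $ j) = 0"
proof -
  have "(\<Sum>j = 0..<N. (diff_mat N xl xr r *\<^sub>v v) $ j)
      = (\<Sum>j = 0..<N. \<Sum>l = 0..<N. diff_mat N xl xr r $$ (j, l) * v $ l)"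
    using assms by (intro sum.cong refl mult_mat_vec_index_sum) auto
  also have "\<dots> = (\<Sum>l = 0..<N. (\<Sum>j = 0..<N. diff_mat N xl xr r $$ (j, l)) * v $ l)"
    unfolding sum_distrib_right by (rule sum.swap)
  also have "\<dots> = 0"
    using assms by (intro sum.neutral) (auto simp: sum_diff_mat_column)
  finally show ?thesis .
qed

section \<open>Invertibility of the implicit operator\<close>

text \<open>For even order the phase shift \<open>m \<pi>\<close> is a sign, and for each mode the form with kernel
  \<open>cos (a\<^sub>j - a\<^sub>l)\<close> is \<open>(\<Sum>j. v\<^sub>j cos a\<^sub>j)\<^sup>2 + (\<Sum>j. v\<^sub>j sin a\<^sub>j)\<^sup>2\<close>.\<close>

lemma diff_mat_even_quadratic_form_sign:
  assumes v: "v \<in> carrier_vec N"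
  shows "0 \<le> (-1) ^ m * (\<Sum>j = 0..<N. v $ j * (diff_mat N xl xr (2 * m) *\<^sub>v v) $ j)"
proof -
  let ?S = "{- (int N div 2)..int N div 2}"
  let ?c = "\<lambda>k. real_of_int k * wave_number xl xr"
  let ?x = "grid_point N xl xr"
  let ?g = "\<lambda>k. 1 / fourier_weight N k * ?c k ^ (2 * m)"
  let ?T = "\<lambda>k j l. v $ j * v $ l * cos (?c k * (?x j - ?x l))"
  have phase: "cos (t + real (2 * m) * (pi / 2)) = (-1) ^ m * cos t" for t
    by (simp add: cos_add)
  have entry: "diff_mat N xl xr (2 * m) $$ (j, l)
      = (-1) ^ m / real N * (\<Sum>k\<in>?S. ?g k * cos (?c k * (?x j - ?x l)))"
    if "j < N" "l < N" for j l
    unfolding diff_mat_index[OF that] phase sum_distrib_left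
    by (intro sum.cong refl) simp
  have square: "(\<Sum>j = 0..<N. \<Sum>l = 0..<N. ?T k j l)
      = (\<Sum>j = 0..<N. v $ j * cos (?c k * ?x j))\<^sup>2 + (\<Sum>j = 0..<N. v $ j * sin (?c k * ?x j))\<^sup>2" for k
    unfolding power2_eq_square sum_product sum.distrib[symmetric]
    by (intro sum.cong refl) (simp add: right_diff_distrib cos_diff algebra_simps)
  have "(\<Sum>j = 0..<N. v $ j * (diff_mat N xl xr (2 * m) *\<^sub>v v) $ j)
      = (\<Sum>j = 0..<N. \<Sum>l = 0..<N. \<Sum>k\<in>?S. (-1) ^ m / real N * (?g k * ?T k j l))"
  proof (intro sum.cong refl)
    fix j assume "j \<in> {0..<N}"
    then have j: "j < N" by simp
    show "v $ j * (diff_mat N xl xr (2 * m) *\<^sub>v v) $ j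
        = (\<Sum>l = 0..<N. \<Sum>k\<in>?S. (-1) ^ m / real N * (?g k * ?T k j l))"
      unfolding mult_mat_vec_index_sum[OF diff_mat_carrier v j] sum_distrib_left
    proof (intro sum.cong refl)
      fix l assume "l \<in> {0..<N}"
      then have l: "l < N" by simp
      show "v $ j * (diff_mat N xl xr (2 * m) $$ (j, l) * v $ l)
          = (\<Sum>k\<in>?S. (-1) ^ m / real N * (?g k * ?T k j l))"
        unfolding entry[OF j l] sum_distrib_left sum_distrib_right
        by (intro sum.cong refl) (simp add: mult_ac)
    qed
  qed
  also have "\<dots> = (\<Sum>j = 0..<N. \<Sum>k\<in>?S. \<Sum>l = 0..<N. (-1) ^ m / real N * (?g k * ?T k j l))"
    by (intro sum.cong refl sum.swap)
  also have "\<dots> = (\<Sum>k\<in>?S. \<Sum>j = 0..<N. \<Sum>l = 0..<N. (-1) ^ m / real N * (?g k * ?T k j l))"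
    by (rule sum.swap)
  also have "\<dots> = (-1) ^ m / real N * (\<Sum>k\<in>?S. ?g k * (\<Sum>j = 0..<N. \<Sum>l = 0..<N. ?T k j l))"
    by (simp only: sum_distrib_left)
  finally have "(-1) ^ m * (\<Sum>j = 0..<N. v $ j * (diff_mat N xl xr (2 * m) *\<^sub>v v) $ j)
      = ((-1) ^ m * (-1) ^ m) / real N * (\<Sum>k\<in>?S. ?g k * (\<Sum>j = 0..<N. \<Sum>l = 0..<N. ?T k j l))"
    by (simp only: times_divide_eq_right times_divide_eq_left mult.assoc)
  moreover have "(-1 :: real) ^ m * (-1) ^ m = 1"
    by (simp flip: power_mult_distrib)
  moreover have "0 \<le> (\<Sum>k\<in>?S. ?g k * (\<Sum>j = 0..<N. \<Sum>l = 0..<N. ?T k j l))"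
    unfolding square by (intro sum_nonneg mult_nonneg_nonneg) (auto simp: fourier_weight_def)
  ultimately show ?thesis by simp
qed

abbreviation implicit_mat :: "nat \<Rightarrow> real \<Rightarrow> real \<Rightarrow> real \<Rightarrow> real \<Rightarrow> real mat" where
  "implicit_mat N xl xr \<delta> \<alpha> \<equiv>
     1\<^sub>m N - \<delta> \<cdot>\<^sub>m diff_mat N xl xr 2 + \<alpha> \<cdot>\<^sub>m diff_mat N xl xr 4"

lemma implicit_mat_carrier: "implicit_mat N xl xr \<delta> \<alpha> \<in> carrier_mat N N"
  by (simp add: add_carrier_mat)

lemma implicit_mat_mult_vec_index:
  assumes v: "v \<in> carrier_vec N" and j: "j < N"
  shows "(implicit_mat N xl xr \<delta> \<alpha> *\<^sub>v v) $ j
    = v $ j - \<delta> * (diff_mat N xl xr 2 *\<^sub>v v) $ j + \<alpha> * (diff_mat N xl xr 4 *\<^sub>v v) $ j"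
proof -
  have "(implicit_mat N xl xr \<delta> \<alpha> *\<^sub>v v) $ j
      = (\<Sum>l = 0..<N. (1\<^sub>m N $$ (j, l) * v $ l - \<delta> * (diff_mat N xl xr 2 $$ (j, l) * v $ l))
          + \<alpha> * (diff_mat N xl xr 4 $$ (j, l) * v $ l))"
    unfolding mult_mat_vec_index_sum[OF implicit_mat_carrier v j]
    using j by (intro sum.cong refl) (auto simp: diff_mat_def algebra_simps)
  also have "\<dots> = (\<Sum>l = 0..<N. 1\<^sub>m N $$ (j, l) * v $ l)
      - \<delta> * (\<Sum>l = 0..<N. diff_mat N xl xr 2 $$ (j, l) * v $ l)
      + \<alpha> * (\<Sum>l = 0..<N. diff_mat N xl xr 4 $$ (j, l) * v $ l)"
    by (simp only: sum.distrib sum_subtractf sum_distrib_left)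
  also have "(\<Sum>l = 0..<N. 1\<^sub>m N $$ (j, l) * v $ l) = v $ j"
    using mult_mat_vec_index_sum[OF one_carrier_mat v j] v by simp
  finally show ?thesis
    by (simp only: mult_mat_vec_index_sum[OF diff_mat_carrier v j])
qed

text \<open>A kernel vector \<open>v\<close> satisfies
  \<open>0 = v \<bullet> v - \<delta> (v \<bullet> D\<^sub>2 v) + \<alpha> (v \<bullet> D\<^sub>4 v) \<ge> v \<bullet> v\<close>.\<close>

lemma implicit_mat_kernel:
  assumes "\<delta> \<ge> 0" "\<alpha> \<ge> 0" and v: "v \<in> carrier_vec N"
    and kernel: "implicit_mat N xl xr \<delta> \<alpha> *\<^sub>v v = 0\<^sub>v N"
  shows "v = 0\<^sub>v N"
proof -
  let ?q = "\<lambda>r. \<Sum>j = 0..<N. v $ j * (diff_mat N xl xr r *\<^sub>v v) $ j"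
  have "0 = (\<Sum>j = 0..<N. v $ j * (implicit_mat N xl xr \<delta> \<alpha> *\<^sub>v v) $ j)"
    by (simp add: kernel)
  also have "\<dots> = (\<Sum>j = 0..<N. (v $ j)\<^sup>2 - \<delta> * (v $ j * (diff_mat N xl xr 2 *\<^sub>v v) $ j)
      + \<alpha> * (v $ j * (diff_mat N xl xr 4 *\<^sub>v v) $ j))"
    by (intro sum.cong refl, subst implicit_mat_mult_vec_index[OF v])
       (auto simp: power2_eq_square algebra_simps)
  also have "\<dots> = (\<Sum>j = 0..<N. (v $ j)\<^sup>2) - \<delta> * ?q 2 + \<alpha> * ?q 4"
    by (simp only: sum.distrib sum_subtractf sum_distrib_left)
  finally have "(\<Sum>j = 0..<N. (v $ j)\<^sup>2) = \<delta> * ?q 2 - \<alpha> * ?q 4"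
    by simp
  moreover have "?q 2 \<le> 0" and "0 \<le> ?q 4"
    using diff_mat_even_quadratic_form_sign[OF v, of 1 xl xr]
      diff_mat_even_quadratic_form_sign[OF v, of 2 xl xr] by simp_all
  then have "\<delta> * ?q 2 \<le> 0" and "0 \<le> \<alpha> * ?q 4"
    using assms by (simp_all add: mult_nonneg_nonpos)
  ultimately have "(\<Sum>j = 0..<N. (v $ j)\<^sup>2) \<le> 0"
    by linarith
  then have "(\<Sum>j = 0..<N. (v $ j)\<^sup>2) = 0"
    by (rule antisym) (simp add: sum_nonneg)
  then have "\<forall>j\<in>{0..<N}. (v $ j)\<^sup>2 = 0"
    by (subst (asm) sum_nonneg_eq_0_iff) auto
  then show ?thesis
    using v by (intro eq_vecI) auto
qed

lemma implicit_mat_inverse: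
  assumes "\<delta> \<ge> 0" "\<alpha> \<ge> 0"
  obtains P where "mat_inverse (implicit_mat N xl xr \<delta> \<alpha>) = Some P"
    and "implicit_mat N xl xr \<delta> \<alpha> * P = 1\<^sub>m N" and "P \<in> carrier_mat N N"
proof -
  let ?A = "implicit_mat N xl xr \<delta> \<alpha>"
  have "det ?A \<noteq> 0"
    unfolding det_0_iff_vec_prod_zero[OF implicit_mat_carrier]
    using implicit_mat_kernel[OF assms] by blast
  then have "?A \<in> Units (ring_mat TYPE(real) N ())"
    by (rule det_non_zero_imp_unit[OF implicit_mat_carrier])
  then obtain P where "mat_inverse ?A = Some P"
    using mat_inverse(1)[OF implicit_mat_carrier] by fastforce
  then show thesis
    using mat_inverse(2)[OF implicit_mat_carrier] that by blast
qed

section \<open>Conservation of mass\<close>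

lemma sum_implicit_mat_mult_vec:
  assumes "xl < xr" and y: "y \<in> carrier_vec N"
  shows "(\<Sum>j = 0..<N. (implicit_mat N xl xr \<delta> \<alpha> *\<^sub>v y) $ j) = (\<Sum>j = 0..<N. y $ j)"
proof -
  have "(\<Sum>j = 0..<N. (implicit_mat N xl xr \<delta> \<alpha> *\<^sub>v y) $ j)
      = (\<Sum>j = 0..<N. y $ j - \<delta> * (diff_mat N xl xr 2 *\<^sub>v y) $ j
          + \<alpha> * (diff_mat N xl xr 4 *\<^sub>v y) $ j)"
    by (intro sum.cong refl implicit_mat_mult_vec_index[OF y]) simp
  also have "\<dots> = (\<Sum>j = 0..<N. y $ j)"
    using assms
    by (simp add: sum.distrib sum_subtractf sum_diff_mat_mult_vec flip: sum_distrib_left)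
  finally show ?thesis .
qed

text \<open>Up to sign, \<open>J_mat\<close> maps \<open>x\<close> to the solution \<open>y\<close> of \<open>A y = D\<^sub>1 x\<close>, and \<open>A\<close> preserves entry sums.\<close>

lemma sum_J_mat_mult_vec:
  assumes "\<delta> \<ge> 0" "\<alpha> \<ge> 0" "xl < xr" and x: "x \<in> carrier_vec N"
  shows "(\<Sum>j = 0..<N. (J_mat N xl xr \<delta> \<alpha> *\<^sub>v x) $ j) = 0"
proof -
  let ?A = "implicit_mat N xl xr \<delta> \<alpha>" and ?D = "diff_mat N xl xr 1"
  obtain P where P: "mat_inverse ?A = Some P" "?A * P = 1\<^sub>m N" "P \<in> carrier_mat N N"
    using implicit_mat_inverse[OF assms(1,2)] by blast
  define y where "y = P *\<^sub>v (?D *\<^sub>v x)"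
  have Dx: "?D *\<^sub>v x \<in> carrier_vec N"
    using x by (metis diff_mat_carrier mult_mat_vec_carrier)
  have y: "y \<in> carrier_vec N"
    unfolding y_def using P(3) Dx by (rule mult_mat_vec_carrier)
  have "?A *\<^sub>v y = (?A * P) *\<^sub>v (?D *\<^sub>v x)"
    unfolding y_def using assoc_mult_mat_vec[OF implicit_mat_carrier P(3) Dx] by simp
  then have Ay: "?A *\<^sub>v y = ?D *\<^sub>v x"
    using P(2) Dx by simp
  have "(\<Sum>j = 0..<N. y $ j) = (\<Sum>j = 0..<N. (?D *\<^sub>v x) $ j)"
    using sum_implicit_mat_mult_vec[OF assms(3) y, of \<delta> \<alpha>] unfolding Ay by simp
  also have "\<dots> = 0"
    using assms by (intro sum_diff_mat_mult_vec) auto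
  finally have "(\<Sum>j = 0..<N. y $ j) = 0" .
  moreover have "J_mat N xl xr \<delta> \<alpha> *\<^sub>v x = - y"
  proof -
    have "J_mat N xl xr \<delta> \<alpha> *\<^sub>v x = - (P * ?D) *\<^sub>v x"
      by (simp add: J_mat_def P(1))
    also have "\<dots> = - ((P * ?D) *\<^sub>v x)"
      using x by (intro uminus_mult_mat_vec) (simp add: diff_mat_def)
    also have "(P * ?D) *\<^sub>v x = y"
      unfolding y_def using P(3) diff_mat_carrier x by (rule assoc_mult_mat_vec)
    finally show ?thesis .
  qed
  ultimately show ?thesis
    using y by (simp add: sum_negf)
qed

theorem theorem2p8:
  fixes \<kappa> b \<beta> \<delta> \<alpha> xl xr \<tau> :: real
    and N s :: nat
    and wt :: "nat \<Rightarrow> real"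
    and a :: "nat \<Rightarrow> nat \<Rightarrow> real"
    and U Q :: "nat \<Rightarrow> real vec"
    and Us Qs K L :: "nat \<Rightarrow> nat \<Rightarrow> real vec"
  assumes "\<delta> > 0" and "\<alpha> > 0" and "xl < xr"
    and "even N" and "N > 0" and "s \<ge> 1" and "\<tau> > 0"
    and U_dim: "\<And>n. U n \<in> carrier_vec N" and Q_dim: "\<And>n. Q n \<in> carrier_vec N"
    and stage_dim:
      "\<And>n i. i \<in> {1..s} \<Longrightarrow> Us n i \<in> carrier_vec N"
      "\<And>n i. i \<in> {1..s} \<Longrightarrow> Qs n i \<in> carrier_vec N"
      "\<And>n i. i \<in> {1..s} \<Longrightarrow> K n i \<in> carrier_vec N"
      "\<And>n i. i \<in> {1..s} \<Longrightarrow> L n i \<in> carrier_vec N"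
    and K_eq: "\<And>n i. i \<in> {1..s} \<Longrightarrow>
      K n i = J_mat N xl xr \<delta> \<alpha> *\<^sub>v
        (\<kappa> \<cdot>\<^sub>v Us n i + b \<cdot>\<^sub>v (diff_mat N xl xr 2 *\<^sub>v Us n i)
          + (\<beta> / 3) \<cdot>\<^sub>v (Qs n i + 2 \<cdot>\<^sub>v (Us n i \<odot> Us n i)))"
    and L_eq: "\<And>n i. i \<in> {1..s} \<Longrightarrow> L n i = 2 \<cdot>\<^sub>v (Us n i \<odot> K n i)"
    and Us_eq: "\<And>n i. i \<in> {1..s} \<Longrightarrow>
      Us n i = U n + \<tau> \<cdot>\<^sub>v finsum_vec TYPE(real) N (\<lambda>j. a i j \<cdot>\<^sub>v K n j) {1..s}"
    and Qs_eq: "\<And>n i. i \<in> {1..s} \<Longrightarrow>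
      Qs n i = Q n + \<tau> \<cdot>\<^sub>v finsum_vec TYPE(real) N (\<lambda>j. a i j \<cdot>\<^sub>v L n j) {1..s}"
    and U_step: "\<And>n.
      U (Suc n) = U n + \<tau> \<cdot>\<^sub>v finsum_vec TYPE(real) N (\<lambda>i. wt i \<cdot>\<^sub>v K n i) {1..s}"
    and Q_step: "\<And>n.
      Q (Suc n) = Q n + \<tau> \<cdot>\<^sub>v finsum_vec TYPE(real) N (\<lambda>i. wt i \<cdot>\<^sub>v L n i) {1..s}"
  shows "\<forall>n. discrete_mass N xl xr (U (Suc n)) = discrete_mass N xl xr (U n)"
proof
  fix n
  let ?sum = "\<lambda>v :: real vec. \<Sum>j = 0..<N. v $ j"
  have stage: "?sum (K n i) = 0" if i: "i \<in> {1..s}" for i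
  proof -
    have "diff_mat N xl xr 2 *\<^sub>v Us n i \<in> carrier_vec N"
      using diff_mat_carrier stage_dim(1)[OF i] by (rule mult_mat_vec_carrier)
    moreover have "Us n i \<odot> Us n i \<in> carrier_vec N"
      using stage_dim(1)[OF i] by (simp add: vec_times_def carrier_vecD)
    ultimately show ?thesis
      unfolding K_eq[OF i] using assms(1-3) stage_dim(1,2)[OF i]
      by (intro sum_J_mat_mult_vec) auto
  qed
  let ?F = "finsum_vec TYPE(real) N (\<lambda>i. wt i \<cdot>\<^sub>v K n i) {1..s}"
  have K_carrier: "(\<lambda>i. wt i \<cdot>\<^sub>v K n i) \<in> {1..s} \<rightarrow> carrier_vec N"
    using stage_dim(3) by auto
  then have F_carrier: "?F \<in> carrier_vec N"
    by (rule finsum_vec_closed)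
  have "?sum ?F = (\<Sum>j = 0..<N. \<Sum>i\<in>{1..s}. wt i * K n i $ j)"
  proof (rule sum.cong[OF refl])
    fix j assume "j \<in> {0..<N}"
    then have j: "j < N" by simp
    have "?F $ j = (\<Sum>i\<in>{1..s}. (wt i \<cdot>\<^sub>v K n i) $ j)"
      by (rule index_finsum_vec[OF _ j K_carrier]) simp
    also have "\<dots> = (\<Sum>i\<in>{1..s}. wt i * K n i $ j)"
      using carrier_vecD[OF stage_dim(3)] j by (intro sum.cong refl index_smult_vec(1)) simp
    finally show "?F $ j = (\<Sum>i\<in>{1..s}. wt i * K n i $ j)" .
  qed
  also have "\<dots> = (\<Sum>i\<in>{1..s}. wt i * ?sum (K n i))"
    unfolding sum_distrib_left by (rule sum.swap)
  also have "\<dots> = 0"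
    by (rule sum.neutral) (simp add: stage)
  finally have "?sum ?F = 0" .
  moreover have "?sum (U (Suc n)) = ?sum (U n) + \<tau> * ?sum ?F"
    unfolding U_step sum_distrib_left sum.distrib[symmetric]
    using F_carrier by (intro sum.cong refl) (auto dest: carrier_vecD)
  ultimately have "?sum (U (Suc n)) = ?sum (U n)"
    by simp
  then show "discrete_mass N xl xr (U (Suc n)) = discrete_mass N xl xr (U n)"
    by (simp add: discrete_mass_def discrete_inner_def ones_vec_def)
qed

end
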